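(* Let $A \in M_n(\mathbb{C})$ be a positive contraction with $A \neq I$, let $B = I-A$, let $0 \leq \delta \leq 1$, and put $$c = \delta\, \frac{\operatorname{tr}(B)^2}{\operatorname{tr}(B^2)}.$$ If $cn$ is a positive integer, then there is a principal submatrix $A_S$ of $A$ of size $cn$ such that $$\|A_S\| \leq 1 - \operatorname{tr}(B)\left[\sqrt{1-c}-\sqrt{\delta-c}\right]^2.$$
   Context: A positive contraction is a hermitian matrix $A$ with $0\le A\le I$. $\operatorname{tr}=\frac1n\operatorname{Tr}$ is the normalized trace on $M_n(\mathbb{C})$ and $\|\cdot\|$ is the operator norm. $A_S$, for $S\subset\{1,\dots,n\}$, is the principal submatrix with rows and columns indexed by $S$. (Note that $0\le c\le\delta$.) *)

theory Defs
  imports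
    "HOL-Analysis.L2_Norm"
    "Jordan_Normal_Form.Schur_Decomposition"
    "Jordan_Normal_Form.DL_Submatrix"
begin

definition vec_l2norm :: "complex vec \<Rightarrow> real" where
  "vec_l2norm v = L2_set (\<lambda>i. cmod (v $ i)) {..<dim_vec v}"

(* The supremum is over the closed unit ball rather than the unit sphere, so that the
   set is nonempty for the matrix with no columns as well (which gets norm 0). *)
definition op_norm :: "complex mat \<Rightarrow> real" where
  "op_norm A = (SUP v \<in> {v \<in> carrier_vec (dim_col A). vec_l2norm v \<le> 1}. vec_l2norm (A *\<^sub>v v))"

definition mat_trace :: "complex mat \<Rightarrow> complex" where
  "mat_trace A = (\<Sum>i<dim_row A. A $$ (i, i))"

definition normalized_trace :: "complex mat \<Rightarrow> complex" where
  "normalized_trace A = mat_trace A / of_nat (dim_row A)"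

definition hermitian_mat :: "complex mat \<Rightarrow> bool" where
  "hermitian_mat A \<longleftrightarrow> square_mat A \<and> mat_adjoint A = A"

(* The quadratic form of a Hermitian matrix is real-valued, so taking Re loses nothing. *)
definition positive_mat :: "complex mat \<Rightarrow> bool" where
  "positive_mat A \<longleftrightarrow> hermitian_mat A \<and>
     (\<forall>v \<in> carrier_vec (dim_row A). 0 \<le> Re ((A *\<^sub>v v) \<bullet>c v))"

(* The conditions 0 \<le> A and A \<le> I refer to the Loewner order. *)
definition positive_contraction :: "complex mat \<Rightarrow> bool" where
  "positive_contraction A \<longleftrightarrow>
     hermitian_mat A \<and> positive_mat A \<and> positive_mat (1\<^sub>m (dim_row A) - A)"

end

theory Submission
  imports Defs "HOL-Analysis.Convex"
begin

text \<open>Indices are deleted greedily while a barrier value increases. Let \<open>X\<close> be the inverse of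
\<open>M = B\<^sub>S - b\<close>, where \<open>M\<close> is positive definite and \<open>t Tr X < 1\<close>. Then \<open>M - t\<close> is positive definite,
and its inverse \<open>N\<close> satisfies \<open>t ((Tr N)\<^sup>2 - Tr (N\<^sup>2)) < Tr N\<close>. Deleting index \<open>i\<close> from \<open>M - t\<close> leaves a
matrix whose inverse has trace \<open>Tr N - (N\<^sup>2)\<^sub>i\<^sub>i / N\<^sub>i\<^sub>i\<close>, so averaging over \<open>i\<close> with weights \<open>N\<^sub>i\<^sub>i\<close>
yields an index whose deletion restores the invariant, now with barrier \<open>b + t\<close>.
Starting from \<open>b = - s\<close> with \<open>s > 0\<close>, this gives \<open>|S| = k\<close> with \<open>B\<^sub>S \<ge> (n - k) t - s\<close>, where \<open>t\<close> can be any
number below \<open>s (s + v) / (n (s + v) - Tr B)\<close> for \<open>v = Tr (B\<^sup>2) / Tr B\<close>. The claim follows by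
optimising over \<open>s\<close>; its supremum, possibly a limit, is reached because there are only finitely many \<open>S\<close>.\<close>

section \<open>Hermitian forms on a finite index set\<close>

text \<open>Matrices are functions here, so that passing to a principal submatrix only shrinks the index set.\<close>

definition sesq :: "'a set \<Rightarrow> ('a \<Rightarrow> 'a \<Rightarrow> complex) \<Rightarrow> ('a \<Rightarrow> complex) \<Rightarrow> ('a \<Rightarrow> complex) \<Rightarrow> complex" where
  "sesq S M x y = (\<Sum>a\<in>S. (\<Sum>b\<in>S. M a b * x b) * cnj (y a))"

definition herm_on :: "'a set \<Rightarrow> ('a \<Rightarrow> 'a \<Rightarrow> complex) \<Rightarrow> bool" where
  "herm_on S M \<longleftrightarrow> (\<forall>a\<in>S. \<forall>b\<in>S. cnj (M a b) = M b a)"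

definition psd_on :: "'a set \<Rightarrow> ('a \<Rightarrow> 'a \<Rightarrow> complex) \<Rightarrow> bool" where
  "psd_on S M \<longleftrightarrow> herm_on S M \<and> (\<forall>x. 0 \<le> Re (sesq S M x x))"

text \<open>Vectors are total functions, so being nonzero has to mean being nonzero somewhere on
  \<open>S\<close>. Every form on the empty set qualifies.\<close>

definition pd_on :: "'a set \<Rightarrow> ('a \<Rightarrow> 'a \<Rightarrow> complex) \<Rightarrow> bool" where
  "pd_on S M \<longleftrightarrow> herm_on S M \<and> (\<forall>x. (\<exists>a\<in>S. x a \<noteq> 0) \<longrightarrow> 0 < Re (sesq S M x x))"

definition kronecker :: "'a \<Rightarrow> 'a \<Rightarrow> complex" where
  "kronecker a b = (if a = b then 1 else 0)"

text \<open>The parameter is a barrier: it lies below the spectrum of \<open>M\<close> as long as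
  \<open>shift M t\<close> is positive definite. Negative values supply the starting
  barrier.\<close>

definition shift :: "('a \<Rightarrow> 'a \<Rightarrow> complex) \<Rightarrow> real \<Rightarrow> 'a \<Rightarrow> 'a \<Rightarrow> complex" where
  "shift M t a b = M a b - complex_of_real t * kronecker a b"

text \<open>Only \<open>M G = 1\<close> is demanded; for hermitian \<open>M\<close> the product in
  the other order follows in \<open>inverse_on_commute\<close>.\<close>

definition inverse_on :: "'a set \<Rightarrow> ('a \<Rightarrow> 'a \<Rightarrow> complex) \<Rightarrow> ('a \<Rightarrow> 'a \<Rightarrow> complex) \<Rightarrow> bool" where
  "inverse_on S M G \<longleftrightarrow> (\<forall>a\<in>S. \<forall>b\<in>S. (\<Sum>k\<in>S. M a k * G k b) = kronecker a b)"

definition trace_on :: "'a set \<Rightarrow> ('a \<Rightarrow> 'a \<Rightarrow> complex) \<Rightarrow> real" where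
  "trace_on S M = (\<Sum>a\<in>S. Re (M a a))"

lemma sum_kronecker [simp]:
  assumes "finite S" "a \<in> S"
  shows "(\<Sum>b\<in>S. kronecker a b * f b) = f a" "(\<Sum>b\<in>S. f b * kronecker a b) = f a"
    "(\<Sum>b\<in>S. kronecker b a * f b) = f a" "(\<Sum>b\<in>S. f b * kronecker b a) = f a"
  using assms by (auto simp: kronecker_def if_distrib[where f = "\<lambda>u. u * _"] if_distrib[where f = "\<lambda>u. _ * u"] cong: if_cong)

lemma cnj_kronecker [simp]: "cnj (kronecker a b) = kronecker a b"
  by (simp add: kronecker_def)

lemma kronecker_commute: "kronecker a b = kronecker b a"
  by (simp add: kronecker_def)

lemma sesq_diff_left: "sesq S M (\<lambda>a. x a - s * y a) z = sesq S M x z - s * sesq S M y z"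
  by (simp add: sesq_def algebra_simps sum_subtractf sum_distrib_left)

lemma sesq_diff_right: "sesq S M z (\<lambda>a. x a - s * y a) = sesq S M z x - cnj s * sesq S M z y"
  by (simp add: sesq_def algebra_simps sum_subtractf sum_distrib_left)

lemma sesq_cnj:
  assumes "herm_on S M"
  shows "cnj (sesq S M x y) = sesq S M y x"
proof -
  have "cnj (sesq S M x y) = (\<Sum>a\<in>S. \<Sum>b\<in>S. cnj (M a b) * cnj (x b) * y a)"
    by (simp add: sesq_def sum_distrib_right)
  also have "\<dots> = (\<Sum>b\<in>S. \<Sum>a\<in>S. cnj (M a b) * cnj (x b) * y a)"
    by (rule sum.swap)
  also have "\<dots> = sesq S M y x"
    using assms by (auto simp: sesq_def sum_distrib_left sum_distrib_right herm_on_def mult_ac intro!: sum.cong)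
  finally show ?thesis .
qed

lemma sesq_real:
  assumes "herm_on S M"
  shows "sesq S M x x = complex_of_real (Re (sesq S M x x))"
  using sesq_cnj[OF assms, of x x] by (simp add: complex_eq_iff)

text \<open>The form is nonnegative at \<open>x - s h y\<close> for every real \<open>s\<close>,
  where \<open>h = <M x, y>\<close>. The factor \<open>h\<close> makes the cross terms real, so a
  real quadratic in \<open>s\<close> remains.\<close>

lemma sesq_cauchy_schwarz:
  assumes "psd_on S M"
  shows "(cmod (sesq S M x y))\<^sup>2 \<le> Re (sesq S M x x) * Re (sesq S M y y)"
proof (cases "sesq S M x y = 0")
  case True
  with assms show ?thesis by (simp add: psd_on_def)
next
  case False
  define h where "h = sesq S M x y"
  define P where "P = Re (sesq S M x x)"
  define Q where "Q = Re (sesq S M y y)"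
  define H where "H = (cmod h)\<^sup>2"
  have herm: "herm_on S M" using assms by (simp add: psd_on_def)
  have Hpos: "H > 0" using False by (simp add: H_def h_def)
  have hh: "cnj h * h = complex_of_real H" "h * cnj h = complex_of_real H"
    unfolding H_def complex_norm_square by (simp_all add: mult.commute)
  have yx: "sesq S M y x = cnj h"
    using sesq_cnj[OF herm, of x y] by (simp add: h_def)
  have quad: "0 \<le> P - 2 * s * H + s\<^sup>2 * H * Q" for s
  proof -
    let ?z = "\<lambda>a. x a - (of_real s * h) * y a"
    have "sesq S M ?z ?z = sesq S M x x - of_real s * (h * cnj h)
        - of_real s * (cnj h * h) + of_real s * of_real s * (h * cnj h) * sesq S M y y"
      unfolding sesq_diff_left sesq_diff_right yx h_def[symmetric]
      by (simp add: algebra_simps)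
    also have "sesq S M x x = of_real P" unfolding P_def by (rule sesq_real[OF herm])
    also have "sesq S M y y = of_real Q" unfolding Q_def by (rule sesq_real[OF herm])
    finally have "sesq S M ?z ?z = of_real P - of_real s * (h * cnj h)
        - of_real s * (cnj h * h) + of_real s * of_real s * (h * cnj h) * of_real Q" .
    then have "sesq S M ?z ?z = of_real (P - 2 * s * H + s\<^sup>2 * H * Q)"
      unfolding hh by (simp add: power2_eq_square algebra_simps)
    moreover have "0 \<le> Re (sesq S M ?z ?z)" using assms by (simp add: psd_on_def)
    ultimately show ?thesis by simp
  qed
  have "Q \<ge> 0" using assms by (simp add: psd_on_def Q_def)
  then consider "Q = 0" | "Q > 0" by linarith
  then have "H \<le> P * Q"
  proof cases
    case 1
    \<comment> \<open>Here the quadratic degenerates to \<open>P - 2 s H\<close>, and this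
      \<open>s\<close> would give it the value \<open>-1\<close>.\<close>
    then show ?thesis using quad[of "(P + 1) / (2 * H)"] Hpos by (simp add: field_simps)
  next
    case 2
    \<comment> \<open>The minimum of the quadratic is at \<open>s = 1 / Q\<close>, with value
      \<open>P - H / Q\<close>.\<close>
    then show ?thesis using quad[of "1 / Q"] Hpos
      by (simp add: field_simps power2_eq_square)
  qed
  then show ?thesis by (simp add: H_def h_def P_def Q_def)
qed

lemma psd_on_herm: "psd_on S M \<Longrightarrow> herm_on S M"
  by (simp add: psd_on_def)

lemma pd_on_herm: "pd_on S M \<Longrightarrow> herm_on S M"
  by (simp add: pd_on_def)

lemma psd_on_nonneg: "psd_on S M \<Longrightarrow> 0 \<le> Re (sesq S M x x)"
  by (simp add: psd_on_def)

lemma pd_on_pos: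
  assumes "pd_on S M" "a \<in> S" "x a \<noteq> 0"
  shows "0 < Re (sesq S M x x)"
proof -
  have "(\<exists>a\<in>S. x a \<noteq> 0) \<longrightarrow> 0 < Re (sesq S M x x)"
    using assms(1) by (simp add: pd_on_def)
  then show ?thesis using assms(2,3) by (auto dest: mp)
qed

lemma pd_imp_psd:
  assumes "pd_on S M"
  shows "psd_on S M"
  unfolding psd_on_def
proof (intro conjI allI)
  show "herm_on S M" using assms by (simp add: pd_on_def)
  fix x
  show "0 \<le> Re (sesq S M x x)"
  proof (cases "\<exists>a\<in>S. x a \<noteq> 0")
    case True
    then have "0 < Re (sesq S M x x)" using assms by (simp add: pd_on_def)
    then show ?thesis by simp
  next
    case False
    then show ?thesis by (simp add: sesq_def)
  qed
qed

lemma sesq_eq_sum: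
  assumes "\<And>a. a \<in> S \<Longrightarrow> (\<Sum>b\<in>S. M a b * x b) = w a"
  shows "sesq S M x y = (\<Sum>a\<in>S. w a * cnj (y a))"
  using assms by (simp add: sesq_def)

lemma herm_on_subset: "herm_on S M \<Longrightarrow> T \<subseteq> S \<Longrightarrow> herm_on T M"
  by (auto simp: herm_on_def)

text \<open>Extension by zero is what carries positivity from a matrix to its principal
  submatrices.\<close>

lemma sesq_subset:
  assumes "finite S" "T \<subseteq> S"
  shows "sesq S M (\<lambda>a. if a \<in> T then x a else 0) (\<lambda>a. if a \<in> T then y a else 0) = sesq T M x y"
proof -
  have inner: "(\<Sum>b\<in>S. M a b * (if b \<in> T then x b else 0)) = (\<Sum>b\<in>T. M a b * x b)" for a
    using assms by (intro sum.mono_neutral_cong_right) auto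
  show ?thesis
    unfolding sesq_def inner
    using assms by (intro sum.mono_neutral_cong_right) auto
qed

lemma psd_on_subset:
  assumes "finite S" "T \<subseteq> S" "psd_on S M"
  shows "psd_on T M"
  unfolding psd_on_def
proof (intro conjI allI)
  show "herm_on T M" using assms herm_on_subset by (auto simp: psd_on_def)
  show "0 \<le> Re (sesq T M x x)" for x
    unfolding sesq_subset[OF assms(1,2), of M x x, symmetric] by (rule psd_on_nonneg[OF assms(3)])
qed

lemma pd_on_subset:
  assumes "finite S" "T \<subseteq> S" "pd_on S M"
  shows "pd_on T M"
  unfolding pd_on_def
proof (intro conjI allI impI)
  show "herm_on T M" using assms herm_on_subset by (auto simp: pd_on_def)
  fix x :: "'a \<Rightarrow> complex" assume "\<exists>a\<in>T. x a \<noteq> 0"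
  then obtain a where a: "a \<in> T" "x a \<noteq> 0" by blast
  have "0 < Re (sesq S M (\<lambda>a. if a \<in> T then x a else 0) (\<lambda>a. if a \<in> T then x a else 0))"
    by (rule pd_on_pos[OF assms(3), of a]) (use a assms(2) in auto)
  then show "0 < Re (sesq T M x x)"
    by (simp only: sesq_subset[OF assms(1,2)])
qed

section \<open>Inverses of positive definite matrices\<close>

text \<open>Induction by bordering with one index; positive definiteness makes the only pivot, the
  Schur complement, nonzero.\<close>

lemma pd_on_inverse:
  assumes "finite S" "pd_on S M"
  shows "\<exists>G. inverse_on S M G"
  using assms
proof (induction S rule: finite_induct)
  case empty
  then show ?case by (simp add: inverse_on_def)
next
  case (insert i S)
  have "pd_on S M" using insert.hyps insert.prems pd_on_subset[of "insert i S" S M] by auto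
  then obtain G where G: "inverse_on S M G" using insert.IH by auto
  txt \<open>\<open>M z\<close> is supported at \<open>i\<close>, where it is the Schur complement \<open>s\<close>.\<close>
  define u where "u a = (\<Sum>b\<in>S. G a b * M b i)" for a
  define z where "z a = (if a = i then 1 else - u a)" for a
  define s where "s = M i i - (\<Sum>a\<in>S. M i a * u a)"
  have Mu: "(\<Sum>k\<in>S. M a k * u k) = M a i" if "a \<in> S" for a
  proof -
    have "(\<Sum>k\<in>S. M a k * u k) = (\<Sum>k\<in>S. \<Sum>b\<in>S. M a k * G k b * M b i)"
      by (simp add: u_def sum_distrib_left mult_ac)
    also have "\<dots> = (\<Sum>b\<in>S. \<Sum>k\<in>S. M a k * G k b * M b i)" by (rule sum.swap)
    also have "\<dots> = (\<Sum>b\<in>S. kronecker a b * M b i)"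
      using G that by (simp add: inverse_on_def flip: sum_distrib_right)
    finally show ?thesis using that insert.hyps by simp
  qed
  have zS: "(\<Sum>k\<in>S. M a k * z k) = - (\<Sum>k\<in>S. M a k * u k)" for a
    using insert.hyps(2) unfolding sum_negf[symmetric]
    by (intro sum.cong) (auto simp: z_def)
  have Mz: "(\<Sum>k\<in>insert i S. M a k * z k) = (if a = i then s else 0)" if "a \<in> insert i S" for a
    using that insert.hyps Mu zS by (auto simp: s_def) (simp_all add: z_def)
  have "sesq (insert i S) M z z = (\<Sum>a\<in>insert i S. (if a = i then s else 0) * cnj (z a))"
    using Mz by (rule sesq_eq_sum)
  also have "\<dots> = s * cnj (z i)"
    using insert.hyps by (subst sum.remove[of _ i]) (auto intro!: sum.neutral)
  finally have "sesq (insert i S) M z z = s" by (simp add: z_def)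
  moreover have "0 < Re (sesq (insert i S) M z z)"
    by (rule pd_on_pos[OF insert.prems, of i]) (auto simp: z_def)
  ultimately have s: "s \<noteq> 0" by auto
  \<comment> \<open>Column \<open>i\<close> of the new inverse is \<open>z / s\<close>. Any other
    column of \<open>G\<close>, padded by zero, produces the unwanted entry \<open>r b\<close> in
    row \<open>i\<close>; subtracting \<open>r b / s\<close> times \<open>z\<close> removes exactly
    that.\<close>
  define r where "r b = (\<Sum>a\<in>S. M i a * G a b)" for b
  define G' where "G' a b = (if b = i then z a / s else (if a = i then 0 else G a b) - z a * r b / s)" for a b
  have "inverse_on (insert i S) M G'"
    unfolding inverse_on_def
  proof (intro ballI)
    fix a b assume a: "a \<in> insert i S" and b: "b \<in> insert i S"
    show "(\<Sum>k\<in>insert i S. M a k * G' k b) = kronecker a b"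
    proof (cases "b = i")
      case True
      have "(\<Sum>k\<in>insert i S. M a k * G' k b) = (\<Sum>k\<in>insert i S. M a k * z k) / s"
        unfolding sum_divide_distrib using True by (simp add: G'_def)
      then show ?thesis using Mz[OF a] s True by (simp add: kronecker_def)
    next
      case False
      have "(\<Sum>k\<in>insert i S. M a k * G' k b) =
          (\<Sum>k\<in>insert i S. M a k * (if k = i then 0 else G k b)) - (\<Sum>k\<in>insert i S. M a k * z k) * r b / s"
        using False unfolding sum_distrib_right sum_divide_distrib sum_subtractf[symmetric]
        by (intro sum.cong refl) (simp add: G'_def right_diff_distrib)
      also have "(\<Sum>k\<in>insert i S. M a k * (if k = i then 0 else G k b)) = (\<Sum>k\<in>S. M a k * G k b)"
        using insert.hyps by (intro sum.mono_neutral_cong_right) auto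
      also have "(\<Sum>k\<in>insert i S. M a k * z k) = (if a = i then s else 0)" by (rule Mz[OF a])
      finally show ?thesis
        using G a b False s by (auto simp: inverse_on_def kronecker_def r_def)
    qed
  qed
  then show ?case by blast
qed

text \<open>With \<open>*\<close> for the adjoint:
  \<open>G* = G* (M G) = (M G)* G = G\<close>.\<close>

lemma inverse_on_herm:
  assumes "finite S" "herm_on S M" "inverse_on S M G"
  shows "herm_on S G"
  unfolding herm_on_def
proof (intro ballI)
  fix a b assume a: "a \<in> S" and b: "b \<in> S"
  have "cnj (G a b) = (\<Sum>c\<in>S. cnj (G c b) * kronecker c a)"
    using assms(1) a by simp
  also have "\<dots> = (\<Sum>c\<in>S. cnj (G c b) * (\<Sum>d\<in>S. M c d * G d a))"
    using assms(3) a by (intro sum.cong) (auto simp: inverse_on_def)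
  also have "\<dots> = (\<Sum>d\<in>S. \<Sum>c\<in>S. cnj (G c b) * (M c d * G d a))"
    unfolding sum_distrib_left by (rule sum.swap)
  also have "\<dots> = (\<Sum>d\<in>S. cnj (\<Sum>c\<in>S. M d c * G c b) * G d a)"
    using assms(2) by (auto simp: herm_on_def sum_distrib_left sum_distrib_right mult_ac intro!: sum.cong)
  also have "\<dots> = (\<Sum>d\<in>S. kronecker d b * G d a)"
    using assms(3) b by (intro sum.cong) (auto simp: inverse_on_def)
  finally show "cnj (G a b) = G b a"
    using assms(1) b by simp
qed

text \<open>Both matrices are hermitian, so taking the adjoint of \<open>M G = 1\<close> reverses
  the product.\<close>

lemma inverse_on_commute:
  assumes "finite S" "herm_on S M" "inverse_on S M G"
  shows "inverse_on S G M"
  unfolding inverse_on_def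
proof (intro ballI)
  fix a b assume a: "a \<in> S" and b: "b \<in> S"
  have G: "herm_on S G" using assms inverse_on_herm by blast
  have "(\<Sum>k\<in>S. G a k * M k b) = cnj (\<Sum>k\<in>S. M b k * G k a)"
    using a b G assms(2) by (auto simp: herm_on_def mult_ac intro!: sum.cong)
  also have "\<dots> = kronecker a b"
    using assms(3) a b by (simp add: inverse_on_def kronecker_commute)
  finally show "(\<Sum>k\<in>S. G a k * M k b) = kronecker a b" .
qed

lemma inverse_on_mult:
  assumes "finite S" "inverse_on S M G" "a \<in> S"
  shows "(\<Sum>k\<in>S. M a k * (\<Sum>b\<in>S. G k b * x b)) = x a"
proof -
  have "(\<Sum>k\<in>S. M a k * (\<Sum>b\<in>S. G k b * x b)) = (\<Sum>b\<in>S. \<Sum>k\<in>S. M a k * (G k b * x b))"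
    unfolding sum_distrib_left by (rule sum.swap)
  also have "\<dots> = (\<Sum>b\<in>S. (\<Sum>k\<in>S. M a k * G k b) * x b)"
    by (simp add: sum_distrib_right mult.assoc)
  also have "\<dots> = (\<Sum>b\<in>S. kronecker a b * x b)"
    using assms by (intro sum.cong) (auto simp: inverse_on_def)
  finally show ?thesis using assms by simp
qed

lemma sesq_kronecker_right:
  assumes "finite S" "a \<in> S"
  shows "sesq S M x (kronecker a) = (\<Sum>b\<in>S. M a b * x b)"
  using assms by (simp add: sesq_def)

lemma sesq_kronecker_kronecker:
  assumes "finite S" "a \<in> S" "b \<in> S"
  shows "sesq S M (kronecker b) (kronecker a) = M a b"
  using assms by (simp add: sesq_kronecker_right)

text \<open>Substituting \<open>y = G x\<close> turns the form of \<open>M\<close> at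
  \<open>y\<close> into the conjugate of the form of \<open>G\<close> at \<open>x\<close>.\<close>

lemma psd_on_inverse:
  assumes "finite S" "psd_on S M" "inverse_on S M G"
  shows "psd_on S G"
  unfolding psd_on_def
proof (intro conjI allI)
  have M: "herm_on S M" using assms(2) by (simp add: psd_on_def)
  then show "herm_on S G" using assms inverse_on_herm by blast
  fix x
  let ?y = "\<lambda>k. \<Sum>b\<in>S. G k b * x b"
  have "sesq S M ?y ?y = (\<Sum>a\<in>S. x a * cnj (?y a))"
    by (rule sesq_eq_sum) (use assms in \<open>simp add: inverse_on_mult\<close>)
  also have "\<dots> = cnj (sesq S G x x)"
    by (simp add: sesq_def mult.commute)
  finally have "Re (sesq S M ?y ?y) = Re (sesq S G x x)" by simp
  moreover have "0 \<le> Re (sesq S M ?y ?y)" using assms(2) by (simp add: psd_on_def)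
  ultimately show "0 \<le> Re (sesq S G x x)" by simp
qed

text \<open>The form of \<open>M\<close> at column \<open>a\<close> of \<open>G\<close> equals
  \<open>cnj (G a a)\<close>, and that column cannot vanish because \<open>M G = 1\<close>.\<close>

lemma pd_on_inverse_diag:
  assumes "finite S" "pd_on S M" "inverse_on S M G" "a \<in> S"
  shows "0 < Re (G a a)"
proof -
  let ?y = "\<lambda>k. G k a"
  have "sesq S M ?y ?y = (\<Sum>b\<in>S. kronecker b a * cnj (?y b))"
    by (rule sesq_eq_sum) (use assms in \<open>simp add: inverse_on_def\<close>)
  also have "\<dots> = cnj (G a a)" using assms by simp
  finally have eq: "sesq S M ?y ?y = cnj (G a a)" .
  have "\<exists>b\<in>S. ?y b \<noteq> 0"
  proof (rule ccontr)
    assume "\<not> ?thesis"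
    then have "(\<Sum>k\<in>S. M a k * G k a) = 0" by simp
    with assms show False by (auto simp: inverse_on_def kronecker_def)
  qed
  then obtain b where "b \<in> S" "G b a \<noteq> 0" by blast
  then have "0 < Re (sesq S M ?y ?y)" by (rule pd_on_pos[OF assms(2)])
  then show ?thesis unfolding eq by simp
qed

text \<open>Since \<open>x a = <M x, G e_a>\<close>, Cauchy-Schwarz bounds each
  \<open>|x a|^2\<close> by \<open><M x, x>\<close> times \<open>G a a\<close>; summing over
  \<open>a\<close> produces the trace. This replaces any appeal to eigenvalues.\<close>

lemma sesq_lower_bound:
  assumes "finite S" "pd_on S M" "inverse_on S M G"
  shows "(\<Sum>a\<in>S. (cmod (x a))\<^sup>2) \<le> Re (sesq S M x x) * trace_on S G"
proof -
  have herm: "herm_on S M" using assms(2) by (simp add: pd_on_def)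
  have "(cmod (x a))\<^sup>2 \<le> Re (sesq S M x x) * Re (G a a)" if a: "a \<in> S" for a
  proof -
    let ?y = "\<lambda>k. G k a"
    have y: "sesq S M ?y z = cnj (z a)" for z
    proof -
      have "sesq S M ?y z = (\<Sum>b\<in>S. kronecker b a * cnj (z b))"
        by (rule sesq_eq_sum) (use assms a in \<open>simp add: inverse_on_def\<close>)
      then show ?thesis using assms a by simp
    qed
    have "sesq S M x ?y = x a"
      using sesq_cnj[OF herm, of ?y x] y[of x] by simp
    then show ?thesis
      using sesq_cauchy_schwarz[OF pd_imp_psd[OF assms(2)], of x ?y] y[of ?y] by simp
  qed
  then have "(\<Sum>a\<in>S. (cmod (x a))\<^sup>2) \<le> (\<Sum>a\<in>S. Re (sesq S M x x) * Re (G a a))"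
    by (rule sum_mono)
  then show ?thesis by (simp add: trace_on_def sum_distrib_left)
qed

section \<open>Shifts by a multiple of the identity\<close>

lemma sum_mult_cnj: "(\<Sum>a\<in>S. x a * cnj (x a)) = complex_of_real (\<Sum>a\<in>S. (cmod (x a))\<^sup>2)"
  unfolding of_real_sum complex_norm_square ..

lemma sesq_shift:
  assumes "finite S"
  shows "sesq S (shift M t) x y = sesq S M x y - of_real t * (\<Sum>a\<in>S. x a * cnj (y a))"
proof -
  have "sesq S (shift M t) x y = (\<Sum>a\<in>S. ((\<Sum>b\<in>S. M a b * x b) - of_real t * x a) * cnj (y a))"
    unfolding sesq_def
  proof (intro sum.cong refl arg_cong2[where f = "(*)"])
    fix a assume "a \<in> S"
    have "(\<Sum>b\<in>S. shift M t a b * x b) = (\<Sum>b\<in>S. M a b * x b) - of_real t * (\<Sum>b\<in>S. kronecker a b * x b)"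
      by (simp add: shift_def left_diff_distrib sum_subtractf sum_distrib_left mult.assoc)
    then show "(\<Sum>b\<in>S. shift M t a b * x b) = (\<Sum>b\<in>S. M a b * x b) - of_real t * x a"
      using assms \<open>a \<in> S\<close> by simp
  qed
  then show ?thesis
    by (simp add: sesq_def left_diff_distrib sum_subtractf sum_distrib_left mult.assoc)
qed

lemma herm_on_shift: "herm_on S M \<Longrightarrow> herm_on S (shift M t)"
  by (simp add: herm_on_def shift_def kronecker_commute)

text \<open>By \<open>sesq_lower_bound\<close> the trace condition keeps \<open>t\<close> strictly
  below the spectrum of \<open>M\<close>.\<close>

lemma pd_on_shift:
  assumes "finite S" "pd_on S M" "inverse_on S M G" "0 \<le> t" "t * trace_on S G < 1"
  shows "pd_on S (shift M t)"
  unfolding pd_on_def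
proof (intro conjI allI impI)
  show "herm_on S (shift M t)" using assms(2) herm_on_shift by (auto simp: pd_on_def)
  fix x :: "'a \<Rightarrow> complex" assume "\<exists>a\<in>S. x a \<noteq> 0"
  then obtain a where "a \<in> S" "x a \<noteq> 0" by blast
  then have pos: "0 < Re (sesq S M x x)" by (rule pd_on_pos[OF assms(2)])
  have "Re (sesq S (shift M t) x x) = Re (sesq S M x x) - t * (\<Sum>a\<in>S. (cmod (x a))\<^sup>2)"
    unfolding sesq_shift[OF assms(1)] sum_mult_cnj by simp
  moreover have "t * (\<Sum>a\<in>S. (cmod (x a))\<^sup>2) \<le> t * (Re (sesq S M x x) * trace_on S G)"
    using sesq_lower_bound[OF assms(1-3), of x] assms(4) by (rule mult_left_mono)
  moreover have "0 < Re (sesq S M x x) * (1 - t * trace_on S G)" using pos assms(5) by simp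
  ultimately show "0 < Re (sesq S (shift M t) x x)" by (simp add: algebra_simps)
qed

lemma shift_shift: "shift (shift M s) t = shift M (s + t)"
  by (simp add: shift_def fun_eq_iff algebra_simps)

section \<open>Greedy deletion of indices\<close>

text \<open>Schur complement formula. The rank-one correction annihilates row \<open>i\<close>, so
  sums over \<open>S - {i}\<close> extend to \<open>S\<close>; there it contributes a multiple of
  \<open>kronecker a i\<close>, which is \<open>0\<close>.\<close>

lemma inverse_on_remove:
  assumes "finite S" "inverse_on S M N" "i \<in> S" "N i i \<noteq> 0"
  shows "inverse_on (S - {i}) M (\<lambda>a b. N a b - N a i * N i b / N i i)"
  unfolding inverse_on_def
proof (intro ballI)
  fix a b assume a: "a \<in> S - {i}" and b: "b \<in> S - {i}"
  let ?G = "\<lambda>a b. N a b - N a i * N i b / N i i"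
  have "(\<Sum>k\<in>S - {i}. M a k * ?G k b) = (\<Sum>k\<in>S. M a k * ?G k b)"
    using assms by (simp add: sum.remove[of S i])
  also have "\<dots> = (\<Sum>k\<in>S. M a k * N k b) - (\<Sum>k\<in>S. M a k * N k i) * (N i b / N i i)"
    by (simp add: right_diff_distrib sum_subtractf sum_distrib_right sum_divide_distrib mult.assoc)
  also have "\<dots> = kronecker a b"
    using a b assms(2,3) by (simp add: inverse_on_def) (simp add: kronecker_def)
  finally show "(\<Sum>k\<in>S - {i}. M a k * ?G k b) = kronecker a b" .
qed

text \<open>The loss is \<open>(N^2) i i / N i i\<close>; as \<open>N\<close> is hermitian, the
  numerator is the squared length of column \<open>i\<close>.\<close>

lemma trace_on_remove:
  assumes "finite S" "herm_on S N" "i \<in> S" "Re (N i i) \<noteq> 0"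
  shows "trace_on (S - {i}) (\<lambda>a b. N a b - N a i * N i b / N i i)
    = trace_on S N - (\<Sum>a\<in>S. (cmod (N a i))\<^sup>2) / Re (N i i)"
proof -
  have ii: "N i i = complex_of_real (Re (N i i))"
  proof -
    have "cnj (N i i) = N i i" using assms(2,3) by (simp add: herm_on_def)
    then show ?thesis by (simp add: complex_eq_iff)
  qed
  have nz: "N i i \<noteq> 0" using assms(4) by auto
  have diag: "Re (N a a - N a i * N i a / N i i) = Re (N a a) - (cmod (N a i))\<^sup>2 / Re (N i i)"
    if "a \<in> S" for a
  proof -
    have "N i a = cnj (N a i)" using assms(2,3) that by (simp add: herm_on_def)
    then have "N a i * N i a = complex_of_real ((cmod (N a i))\<^sup>2)"
      by (simp only: complex_norm_square)
    then have "N a i * N i a / N i i = complex_of_real ((cmod (N a i))\<^sup>2 / Re (N i i))"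
      by (subst ii) (simp only: of_real_divide)
    then show ?thesis by (simp only: minus_complex.sel Re_complex_of_real)
  qed
  \<comment> \<open>The corrected diagonal entry at \<open>i\<close> is zero, so that index may be
    added back.\<close>
  have "trace_on (S - {i}) (\<lambda>a b. N a b - N a i * N i b / N i i)
      = (\<Sum>a\<in>S. Re (N a a - N a i * N i a / N i i))"
    unfolding trace_on_def using sum.remove[OF assms(1,3), of "\<lambda>a. Re (N a a - N a i * N i a / N i i)"] nz
    by simp
  also have "\<dots> = (\<Sum>a\<in>S. Re (N a a) - (cmod (N a i))\<^sup>2 / Re (N i i))"
    by (rule sum.cong[OF refl diag])
  finally show ?thesis by (simp add: trace_on_def sum_subtractf sum_divide_distrib)
qed

text \<open>From \<open>(M - t) N = 1\<close> comes \<open>M N = 1 + t N\<close>; multiplying by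
  \<open>X\<close> on the left yields the resolvent identity \<open>N = X + t X N\<close>.\<close>

lemma resolvent_on:
  assumes "finite S" "herm_on S M" "inverse_on S M X" "inverse_on S (shift M t) N"
    and "a \<in> S" "b \<in> S"
  shows "N a b = X a b + of_real t * (\<Sum>k\<in>S. X a k * N k b)"
proof -
  have MN: "(\<Sum>j\<in>S. M k j * N j b) = kronecker k b + of_real t * N k b" if k: "k \<in> S" for k
  proof -
    have "kronecker k b = (\<Sum>j\<in>S. shift M t k j * N j b)"
      using assms k by (simp add: inverse_on_def)
    also have "\<dots> = (\<Sum>j\<in>S. M k j * N j b) - of_real t * (\<Sum>j\<in>S. kronecker k j * N j b)"
      by (simp add: shift_def left_diff_distrib sum_subtractf sum_distrib_left mult.assoc)
    finally show ?thesis using assms k by simp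
  qed
  have "N a b = (\<Sum>k\<in>S. X a k * (\<Sum>j\<in>S. M k j * N j b))"
    using inverse_on_mult[OF assms(1) inverse_on_commute[OF assms(1-3)] assms(5), of "\<lambda>j. N j b"]
    by simp
  also have "\<dots> = (\<Sum>k\<in>S. X a k * (kronecker k b + of_real t * N k b))"
    using MN by (intro sum.cong) auto
  also have "\<dots> = (\<Sum>k\<in>S. X a k * kronecker k b) + of_real t * (\<Sum>k\<in>S. X a k * N k b)"
    by (simp add: distrib_left sum.distrib sum_distrib_left mult.left_commute)
  finally show ?thesis using assms by simp
qed

text \<open>The resolvent identity expresses \<open>Tr N\<close> and \<open>F = Tr (N^2)\<close>
  through the traces of \<open>X\<close>, \<open>X N\<close> and \<open>N X N\<close>, which are
  linked by a Cauchy-Schwarz inequality.\<close>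

lemma trace_shift_inverse:
  fixes S :: "'a set" and M X N :: "'a \<Rightarrow> 'a \<Rightarrow> complex"
  defines "F \<equiv> \<Sum>b\<in>S. \<Sum>a\<in>S. (cmod (N a b))\<^sup>2"
  assumes fin: "finite S" and ne: "S \<noteq> {}" and M: "pd_on S M" and X: "inverse_on S M X"
    and t: "0 < t" "t * trace_on S X < 1"
    and N: "inverse_on S (shift M t) N"
  shows "t * ((trace_on S N)\<^sup>2 - F) < trace_on S N"
proof -
  have hM: "herm_on S M" and psdX: "psd_on S X"
    using M X fin pd_on_herm pd_imp_psd psd_on_inverse by blast+
  have hX: "herm_on S X" using psdX by (rule psd_on_herm)
  have pdN: "pd_on S (shift M t)" using pd_on_shift[OF fin M X] t by simp
  have hN: "herm_on S N" using inverse_on_herm[OF fin pd_on_herm[OF pdN] N] .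
  define T where "T = trace_on S X"
  \<comment> \<open>\<open>p\<close> is \<open>Tr (X N)\<close> and \<open>q\<close> is
    \<open>Tr (N X N)\<close>, both computed column by column.\<close>
  define p where "p = (\<Sum>b\<in>S. Re (\<Sum>k\<in>S. X b k * N k b))"
  define q where "q = (\<Sum>b\<in>S. Re (sesq S X (\<lambda>a. N a b) (\<lambda>a. N a b)))"
  note res = resolvent_on[OF fin hM X N]
  have tau: "trace_on S N = T + t * p"
  proof -
    have "trace_on S N = (\<Sum>b\<in>S. Re (X b b + of_real t * (\<Sum>k\<in>S. X b k * N k b)))"
      unfolding trace_on_def by (intro sum.cong refl arg_cong[where f = Re] res)
    then show ?thesis
      by (simp add: T_def trace_on_def p_def sum.distrib sum_distrib_left)
  qed
  have cross: "sesq S X (\<lambda>a. N a b) (kronecker b) = (\<Sum>k\<in>S. X b k * N k b)" if "b \<in> S" for b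
    using fin that by (rule sesq_kronecker_right)
  \<comment> \<open>The identity is substituted into one of the two factors of
    \<open>Tr (N^2)\<close>.\<close>
  have F: "F = p + t * q"
  proof -
    have "(\<Sum>a\<in>S. (cmod (N a b))\<^sup>2)
        = Re (\<Sum>k\<in>S. X b k * N k b) + t * Re (sesq S X (\<lambda>a. N a b) (\<lambda>a. N a b))"
      if b: "b \<in> S" for b
    proof -
      have "complex_of_real (\<Sum>a\<in>S. (cmod (N a b))\<^sup>2) = (\<Sum>a\<in>S. N a b * cnj (N a b))"
        by (rule sum_mult_cnj[symmetric])
      also have "\<dots> = (\<Sum>a\<in>S. (X a b + of_real t * (\<Sum>k\<in>S. X a k * N k b)) * cnj (N a b))"
        using b by (intro sum.cong refl arg_cong2[where f = "(*)"] res)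
      also have "\<dots> = (\<Sum>a\<in>S. X a b * cnj (N a b)) + of_real t * sesq S X (\<lambda>a. N a b) (\<lambda>a. N a b)"
        by (simp add: sesq_def distrib_right sum.distrib)
          (simp add: sum_distrib_left sum_distrib_right mult.assoc)
      also have "(\<Sum>a\<in>S. X a b * cnj (N a b)) = sesq S X (kronecker b) (\<lambda>a. N a b)"
        using fin b by (simp add: sesq_def)
      also have "\<dots> = cnj (\<Sum>k\<in>S. X b k * N k b)"
        using sesq_cnj[OF hX, of "\<lambda>a. N a b" "kronecker b"] cross[OF b] by simp
      finally have "Re (complex_of_real (\<Sum>a\<in>S. (cmod (N a b))\<^sup>2)) = Re (cnj (\<Sum>k\<in>S. X b k * N k b)
        + of_real t * sesq S X (\<lambda>a. N a b) (\<lambda>a. N a b))" by (rule arg_cong)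
      then show ?thesis by simp
    qed
    then show ?thesis
      by (simp add: F_def p_def q_def sum.distrib sum_distrib_left)
  qed
  txt \<open>Expands \<open>Tr ((N - s) X (N - s)) \<ge> 0\<close>; its discriminant gives \<open>p\<^sup>2 \<le> q T\<close>.\<close>
  have quad: "0 \<le> q - 2 * s * p + s\<^sup>2 * T" for s
  proof -
    let ?y = "\<lambda>b a. N a b - of_real s * kronecker b a"
    have "Re (sesq S X (?y b) (?y b)) = Re (sesq S X (\<lambda>a. N a b) (\<lambda>a. N a b))
        - 2 * s * Re (\<Sum>k\<in>S. X b k * N k b) + s\<^sup>2 * Re (X b b)" if b: "b \<in> S" for b
    proof -
      have "sesq S X (kronecker b) (\<lambda>a. N a b) = cnj (\<Sum>k\<in>S. X b k * N k b)"
        using sesq_cnj[OF hX, of "\<lambda>a. N a b" "kronecker b"] cross[OF b] by simp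
      then have "sesq S X (?y b) (?y b) = sesq S X (\<lambda>a. N a b) (\<lambda>a. N a b)
        - of_real s * cnj (\<Sum>k\<in>S. X b k * N k b) - of_real s * (\<Sum>k\<in>S. X b k * N k b)
        + of_real s * of_real s * X b b"
        unfolding sesq_diff_left sesq_diff_right cross[OF b] sesq_kronecker_kronecker[OF fin b b]
        by (simp add: algebra_simps del: cnj_sum)
      then show ?thesis by (simp add: power2_eq_square del: cnj_sum Re_sum)
    qed
    then have "(\<Sum>b\<in>S. Re (sesq S X (?y b) (?y b))) = q - 2 * s * p + s\<^sup>2 * T"
      by (simp add: q_def p_def T_def trace_on_def sum.distrib sum_subtractf sum_distrib_left del: Re_sum)
    moreover have "0 \<le> (\<Sum>b\<in>S. Re (sesq S X (?y b) (?y b)))"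
      by (intro sum_nonneg psd_on_nonneg[OF psdX])
    ultimately show ?thesis by simp
  qed
  have Tpos: "0 < T"
    unfolding T_def trace_on_def using fin ne pd_on_inverse_diag[OF fin M X] by (simp add: sum_pos)
  have taupos: "0 < trace_on S N"
    unfolding trace_on_def using fin ne pd_on_inverse_diag[OF fin pdN N] by (simp add: sum_pos)
  have Fnn: "0 \<le> F" unfolding F_def by (intro sum_nonneg) auto
  have "p\<^sup>2 \<le> q * T"
    using quad[of "p / T"] Tpos by (simp add: field_simps power2_eq_square)
  \<comment> \<open>Both sides contain \<open>T p\<close>; what remains is
    \<open>t p^2 \<le> t q T\<close>.\<close>
  then have le: "trace_on S N * p \<le> F * T"
    using t(1) unfolding tau F by (simp add: algebra_simps power2_eq_square mult_left_mono)
  have "t * (trace_on S N)\<^sup>2 = t * T * trace_on S N + t * (t * (trace_on S N * p))"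
    unfolding tau by (simp add: algebra_simps power2_eq_square)
  also have "\<dots> \<le> t * T * trace_on S N + t * (t * (F * T))"
    using le t(1) by (intro add_left_mono mult_left_mono) auto
  also have "\<dots> = t * T * trace_on S N + t * T * (t * F)" by (simp add: mult_ac)
  \<comment> \<open>The condition \<open>t T < 1\<close> is applied to both terms; strictness comes
    from \<open>Tr N > 0\<close>.\<close>
  also have "\<dots> < trace_on S N + t * F"
    using t taupos Fnn unfolding T_def[symmetric]
    by (intro add_less_le_mono mult_left_le_one_le) (simp_all add: Tpos less_imp_le)
  finally show ?thesis by (simp add: right_diff_distrib)
qed

text \<open>If every index failed, the failed inequalities multiplied by the weights
  \<open>N i i > 0\<close> would add up to \<open>Tr N \<le> t ((Tr N)^2 - Tr (N^2))\<close>,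
  contradicting \<open>trace_shift_inverse\<close>.\<close>

lemma remove_one:
  assumes fin: "finite S" and ne: "S \<noteq> {}" and M: "pd_on S M" and X: "inverse_on S M X"
    and t: "0 < t" "t * trace_on S X < 1"
  obtains i G where "i \<in> S" "pd_on (S - {i}) (shift M t)"
    "inverse_on (S - {i}) (shift M t) G" "t * trace_on (S - {i}) G < 1"
proof -
  have pd: "pd_on S (shift M t)" using pd_on_shift[OF fin M X] t by simp
  obtain N where N: "inverse_on S (shift M t) N" using pd_on_inverse[OF fin pd] by blast
  have hN: "herm_on S N" using inverse_on_herm[OF fin pd_on_herm[OF pd] N] .
  define f where "f i = (\<Sum>a\<in>S. (cmod (N a i))\<^sup>2)" for i
  have pos: "0 < Re (N i i)" if "i \<in> S" for i using pd_on_inverse_diag[OF fin pd N that] .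
  have "\<exists>i\<in>S. t * (trace_on S N - f i / Re (N i i)) < 1"
  proof (rule ccontr)
    assume "\<not> ?thesis"
    then have ge: "1 \<le> t * (trace_on S N - f i / Re (N i i))" if "i \<in> S" for i
      using that by (force simp: not_less)
    have "Re (N i i) \<le> t * (trace_on S N * Re (N i i) - f i)" if "i \<in> S" for i
    proof -
      have "1 * Re (N i i) \<le> t * (trace_on S N - f i / Re (N i i)) * Re (N i i)"
        using pos[OF that] by (intro mult_right_mono ge[OF that]) simp
      also have "\<dots> = t * (trace_on S N * Re (N i i) - f i)"
        using pos[OF that] by (simp add: left_diff_distrib right_diff_distrib)
      finally show ?thesis by simp
    qed
    then have "(\<Sum>i\<in>S. Re (N i i)) \<le> (\<Sum>i\<in>S. t * (trace_on S N * Re (N i i) - f i))"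
      by (rule sum_mono)
    also have "\<dots> = t * ((trace_on S N)\<^sup>2 - (\<Sum>i\<in>S. f i))"
      by (simp add: sum_distrib_left[symmetric] sum_subtractf power2_eq_square trace_on_def)
    finally show False
      using trace_shift_inverse[OF fin ne M X t N] by (simp add: f_def trace_on_def)
  qed
  then obtain i where i: "i \<in> S" "t * (trace_on S N - f i / Re (N i i)) < 1" by blast
  have "N i i \<noteq> 0" "Re (N i i) \<noteq> 0" using pos[OF i(1)] by auto
  show thesis
  proof (rule that[OF i(1)])
    show "pd_on (S - {i}) (shift M t)" by (rule pd_on_subset[OF fin _ pd]) auto
    show "inverse_on (S - {i}) (shift M t) (\<lambda>a b. N a b - N a i * N i b / N i i)"
      using fin N i(1) \<open>N i i \<noteq> 0\<close> by (rule inverse_on_remove)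
    show "t * trace_on (S - {i}) (\<lambda>a b. N a b - N a i * N i b / N i i) < 1"
      using i(2) trace_on_remove[OF fin hN i(1) \<open>Re (N i i) \<noteq> 0\<close>] by (simp add: f_def)
  qed
qed

text \<open>The invariant has the same form before and after a deletion, so one fixed step
  \<open>t\<close> serves throughout and the barrier rises linearly.\<close>

lemma remove_many:
  assumes fin: "finite S" and M: "pd_on S M" and X: "inverse_on S M X"
    and t: "0 < t" "t * trace_on S X < 1"
    and j: "j \<le> card S"
  shows "\<exists>T G. T \<subseteq> S \<and> card T = card S - j \<and> pd_on T (shift M (real j * t)) \<and>
    inverse_on T (shift M (real j * t)) G \<and> t * trace_on T G < 1"
  using j
proof (induction j)
  case 0
  have "shift M 0 = M" by (simp add: shift_def fun_eq_iff)
  then show ?case using M X t by auto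
next
  case (Suc j)
  then obtain T G where T: "T \<subseteq> S" "card T = card S - j" "pd_on T (shift M (real j * t))"
    "inverse_on T (shift M (real j * t)) G" "t * trace_on T G < 1" by auto
  have finT: "finite T" using T(1) fin finite_subset by blast
  have "card T > 0" using T(2) Suc.prems by simp
  then have neT: "T \<noteq> {}" by auto
  obtain i H where i: "i \<in> T" "pd_on (T - {i}) (shift M (real (Suc j) * t))"
    "inverse_on (T - {i}) (shift M (real (Suc j) * t)) H" "t * trace_on (T - {i}) H < 1"
    using remove_one[OF finT neT T(3,4) t(1) T(5)]
    by (auto simp: shift_shift algebra_simps)
  have "card (T - {i}) = card S - Suc j" using i(1) T(2) finT by simp
  moreover have "T - {i} \<subseteq> S" using T(1) by auto
  ultimately show ?case using i by blast
qed

section \<open>The initial trace and the choice of the barrier\<close>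

text \<open>For an eigenvalue \<open>\<lambda>\<close> of \<open>B\<close> this is the inequality between \<open>\<lambda> / (\<lambda> + t)\<close> and the quadratic in \<open>\<lambda>\<close>
vanishing at \<open>0\<close> and tangent to it at \<open>v\<close>; the proof tests \<open>t B + B\<^sup>2\<close> on the columns of
\<open>1 - (t + v) X\<close>.\<close>

lemma trace_inverse_bound:
  assumes fin: "finite S" and B: "psd_on S B" and t: "0 < t" and v: "0 \<le> v"
    and F: "(\<Sum>a\<in>S. \<Sum>c\<in>S. (cmod (B c a))\<^sup>2) = v * trace_on S B"
    and X: "inverse_on S (shift B (- t)) X"
  shows "t * (t + v) * trace_on S X \<le> real (card S) * (t + v) - trace_on S B"
proof -
  define w where "w = t + v"
  have wpos: "0 < w" using t v by (simp add: w_def)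
  have hB: "herm_on S B" using B by (rule psd_on_herm)
  have BX: "(\<Sum>k\<in>S. B c k * X k a) = kronecker c a - of_real t * X c a" if "c \<in> S" "a \<in> S" for c a
  proof -
    have "kronecker c a = (\<Sum>k\<in>S. shift B (- t) c k * X k a)"
      using X that by (simp add: inverse_on_def)
    also have "\<dots> = (\<Sum>k\<in>S. B c k * X k a) + of_real t * (\<Sum>k\<in>S. kronecker c k * X k a)"
      by (simp add: shift_def distrib_right sum.distrib sum_distrib_left mult.assoc)
    finally show ?thesis using fin that by simp
  qed
  have main: "0 \<le> (\<Sum>c\<in>S. (cmod (B c a))\<^sup>2) - (v + w) * Re (B a a) + w * w
      - w * w * t * Re (X a a)" if a: "a \<in> S" for a
  proof -
    \<comment> \<open>\<open>y\<close> is column \<open>a\<close> of \<open>1 - w X\<close>, and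
      \<open>z\<close> is \<open>B y\<close> simplified by \<open>B X = 1 - t X\<close>.\<close>
    define y where "y c = kronecker c a - of_real w * X c a" for c
    define z where "z c = B c a - of_real w * kronecker c a + of_real (w * t) * X c a" for c
    have By: "(\<Sum>k\<in>S. B c k * y k) = z c" if "c \<in> S" for c
    proof -
      have "(\<Sum>k\<in>S. B c k * y k) = (\<Sum>k\<in>S. B c k * kronecker k a) - of_real w * (\<Sum>k\<in>S. B c k * X k a)"
        by (simp add: y_def right_diff_distrib sum_subtractf sum_distrib_left mult.left_commute)
      then show ?thesis using BX[OF that a] fin a by (simp add: z_def algebra_simps)
    qed
    \<comment> \<open>The choice \<open>w = t + v\<close> cancels \<open>X\<close> here, so
      \<open><z, t y + z>\<close> is only linear in \<open>X\<close>.\<close>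
    have tyz: "of_real t * y c + z c = B c a - of_real v * kronecker c a" for c
      by (simp add: y_def z_def w_def algebra_simps)
    have "0 \<le> t * Re (sesq S B y y) + (\<Sum>c\<in>S. (cmod (z c))\<^sup>2)"
      using t psd_on_nonneg[OF B] by (intro add_nonneg_nonneg mult_nonneg_nonneg sum_nonneg) auto
    also have "\<dots> = Re (of_real t * sesq S B y y + complex_of_real (\<Sum>c\<in>S. (cmod (z c))\<^sup>2))"
      by simp
    also have "of_real t * sesq S B y y + complex_of_real (\<Sum>c\<in>S. (cmod (z c))\<^sup>2)
        = (\<Sum>c\<in>S. z c * cnj (of_real t * y c + z c))"
      unfolding sum_mult_cnj[symmetric] using sesq_eq_sum[of S B y z y, OF By]
      by (simp add: distrib_left sum.distrib sum_distrib_left mult.left_commute)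
    also have "\<dots> = (\<Sum>c\<in>S. z c * cnj (B c a)) - of_real v * (\<Sum>c\<in>S. z c * kronecker c a)"
      unfolding tyz by (simp add: right_diff_distrib sum_subtractf sum_distrib_left mult.left_commute)
    also have "(\<Sum>c\<in>S. z c * kronecker c a) = B a a - of_real w + of_real (w * t) * X a a"
      using fin a by (simp add: z_def) (simp add: kronecker_def)
    also have "(\<Sum>c\<in>S. z c * cnj (B c a)) = (\<Sum>c\<in>S. B c a * cnj (B c a))
        - of_real w * (\<Sum>c\<in>S. kronecker c a * cnj (B c a)) + of_real (w * t) * (\<Sum>c\<in>S. X c a * cnj (B c a))"
      by (simp add: z_def left_diff_distrib distrib_right sum.distrib sum_subtractf sum_distrib_left mult.assoc)
    also have "(\<Sum>c\<in>S. B c a * cnj (B c a)) = complex_of_real (\<Sum>c\<in>S. (cmod (B c a))\<^sup>2)"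
      by (rule sum_mult_cnj)
    also have "(\<Sum>c\<in>S. kronecker c a * cnj (B c a)) = cnj (B a a)"
      using fin a by simp
    also have "(\<Sum>c\<in>S. X c a * cnj (B c a)) = (\<Sum>c\<in>S. B a c * X c a)"
      using hB a by (intro sum.cong) (auto simp: herm_on_def)
    also have "\<dots> = 1 - of_real t * X a a"
      using BX[OF a a] by (simp add: kronecker_def)
    finally show ?thesis by (simp add: w_def algebra_simps)
  qed
  have "0 \<le> (\<Sum>a\<in>S. (\<Sum>c\<in>S. (cmod (B c a))\<^sup>2) - (v + w) * Re (B a a) + w * w
      - w * w * t * Re (X a a))"
    using main by (rule sum_nonneg)
  also have "\<dots> = v * trace_on S B - (v + w) * trace_on S B + real (card S) * (w * w)
      - w * w * t * trace_on S X"
    unfolding F[symmetric] by (simp add: sum.distrib sum_subtractf trace_on_def sum_distrib_left)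
  \<comment> \<open>By \<open>F\<close> the terms with \<open>v * trace_on S B\<close> cancel, which
    leaves a common factor \<open>w\<close>.\<close>
  also have "\<dots> = w * (real (card S) * w - trace_on S B - t * w * trace_on S X)"
    by (simp add: algebra_simps)
  finally have "0 \<le> real (card S) * w - trace_on S B - t * w * trace_on S X"
    using wpos by (subst (asm) zero_le_mult_iff) auto
  then show ?thesis by (simp add: w_def)
qed

text \<open>Here \<open>t\<close> is the depth of the starting barrier \<open>-t\<close> and
  \<open>s\<close> the step per deletion. The bound on \<open>s\<close>, combined with
  \<open>trace_inverse_bound\<close>, is the initial invariant \<open>s Tr X < 1\<close>; then
  \<open>card S - k\<close> indices are deleted.\<close>

lemma restricted_lower_bound:
  assumes fin: "finite S" and B: "psd_on S B" and t: "0 < t" and v: "0 \<le> v"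
    and F: "(\<Sum>a\<in>S. \<Sum>c\<in>S. (cmod (B c a))\<^sup>2) = v * trace_on S B"
    and s: "0 < s" "s * (real (card S) * (t + v) - trace_on S B) < t * (t + v)"
    and k: "k \<le> card S"
  shows "\<exists>T \<subseteq> S. card T = k \<and> psd_on T (shift B (real (card S - k) * s - t))"
proof -
  have "herm_on S (shift B (- t))" using B psd_on_herm herm_on_shift by blast
  moreover have "0 < Re (sesq S (shift B (- t)) x x)" if x: "a \<in> S" "x a \<noteq> 0" for x a
  proof -
    have "0 < (\<Sum>a\<in>S. (cmod (x a))\<^sup>2)"
      using fin x by (intro sum_pos2[of _ a]) auto
    moreover have "Re (sesq S (shift B (- t)) x x) = Re (sesq S B x x) + t * (\<Sum>a\<in>S. (cmod (x a))\<^sup>2)"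
      unfolding sesq_shift[OF fin] sum_mult_cnj by simp
    ultimately show ?thesis using psd_on_nonneg[OF B, of x] t by (simp add: add_nonneg_pos)
  qed
  ultimately have pd: "pd_on S (shift B (- t))" unfolding pd_on_def by auto
  then obtain X where X: "inverse_on S (shift B (- t)) X" using pd_on_inverse fin by blast
  have "(t * (t + v)) * (s * trace_on S X) = s * (t * (t + v) * trace_on S X)" by (simp add: mult_ac)
  also have "\<dots> \<le> s * (real (card S) * (t + v) - trace_on S B)"
    using trace_inverse_bound[OF fin B t v F X] s(1) by (simp add: mult_left_mono)
  also have "\<dots> < t * (t + v) * 1" using s(2) by simp
  finally have "s * trace_on S X < 1"
    using t v by (subst (asm) mult_less_cancel_left_pos) auto
  then obtain T where "T \<subseteq> S" "card T = card S - (card S - k)"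
    "pd_on T (shift (shift B (- t)) (real (card S - k) * s))"
    using remove_many[OF fin pd X s(1), of "card S - k"] by auto
  then show ?thesis using k pd_imp_psd by (auto simp: shift_shift)
qed

text \<open>For \<open>y = A x\<close> and \<open>E = |A x|^2\<close>, Cauchy-Schwarz for the form
  of \<open>A\<close> gives \<open>E^2 \<le> <A x, x> <A y, y> \<le> r P * r E\<close>, and
  \<open>E\<close> cancels.\<close>

lemma psd_on_operator_bound:
  assumes A: "psd_on S A" and le: "\<And>x. Re (sesq S A x x) \<le> r * (\<Sum>a\<in>S. (cmod (x a))\<^sup>2)"
  shows "(\<Sum>a\<in>S. (cmod (\<Sum>b\<in>S. A a b * x b))\<^sup>2) \<le> r\<^sup>2 * (\<Sum>a\<in>S. (cmod (x a))\<^sup>2)"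
proof -
  define y where "y a = (\<Sum>b\<in>S. A a b * x b)" for a
  define E where "E = (\<Sum>a\<in>S. (cmod (y a))\<^sup>2)"
  define P where "P = (\<Sum>a\<in>S. (cmod (x a))\<^sup>2)"
  have nn: "0 \<le> E" "0 \<le> P" by (simp_all add: E_def P_def sum_nonneg)
  have "sesq S A x y = complex_of_real E"
    unfolding E_def sum_mult_cnj[symmetric] by (simp add: sesq_def y_def)
  then have "E\<^sup>2 = (cmod (sesq S A x y))\<^sup>2" by simp
  also have "\<dots> \<le> Re (sesq S A x x) * Re (sesq S A y y)" by (rule sesq_cauchy_schwarz[OF A])
  also have "\<dots> \<le> (r * P) * (r * E)"
    using le psd_on_nonneg[OF A] unfolding E_def P_def by (intro mult_mono) (auto intro: order_trans)
  finally have "E * E \<le> r\<^sup>2 * P * E" by (simp add: power2_eq_square mult_ac)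
  then have "E \<le> r\<^sup>2 * P"
    using nn by (cases "E = 0") (auto simp: mult_le_cancel_right)
  then show ?thesis by (simp add: E_def P_def y_def)
qed

text \<open>With \<open>a = v - \<mu>\<close> and \<open>w = t + a\<close> the expression becomes
  \<open>c a + (1 - c) \<mu> - c w - (1 - c) a \<mu> / w\<close>, whose maximum over
  \<open>w > 0\<close> follows from the arithmetic-geometric mean inequality when
  \<open>a > 0\<close>.\<close>

lemma optimise_shift:
  fixes \<mu> v c \<delta> e :: real
  assumes \<mu>: "0 < \<mu>" and c: "0 < c" "c \<le> \<delta>" and \<delta>: "\<delta> \<le> 1" and v: "c * v = \<delta> * \<mu>"
    and e: "\<And>t. 0 < t \<Longrightarrow> (1 - c) * (t * (t + v) / (t + v - \<mu>)) - t \<le> e"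
  shows "\<mu> * (sqrt (1 - c) - sqrt (\<delta> - c))\<^sup>2 \<le> e"
proof -
  define a where "a = v - \<mu>"
  have ca: "c * a = \<mu> * (\<delta> - c)" using v by (simp add: a_def algebra_simps)
  have "0 \<le> c * a" using ca \<mu> c by simp
  then have a: "0 \<le> a" using c(1) by (simp add: zero_le_mult_iff)
  \<comment> \<open>The balance point of the two terms in \<open>w\<close>, that is,
    \<open>c u^2 = (1 - c) a \<mu>\<close>.\<close>
  define u where "u = \<mu> * sqrt (1 - c) * sqrt (\<delta> - c) / c"
  have sq: "(sqrt (1 - c))\<^sup>2 = 1 - c" "(sqrt (\<delta> - c))\<^sup>2 = \<delta> - c" using c \<delta> by auto
  have u0: "0 \<le> u" using \<mu> c \<delta> by (simp add: u_def)
  have "(c * u)\<^sup>2 = \<mu>\<^sup>2 * (sqrt (1 - c))\<^sup>2 * (sqrt (\<delta> - c))\<^sup>2"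
    using c(1) by (simp add: u_def power_mult_distrib)
  also have "\<dots> = (1 - c) * \<mu> * (\<mu> * (\<delta> - c))" unfolding sq by (simp add: power2_eq_square)
  also have "\<dots> = c * ((1 - c) * a * \<mu>)" unfolding ca[symmetric] by simp
  finally have "c * (c * u\<^sup>2) = c * ((1 - c) * a * \<mu>)" by (simp add: power2_eq_square mult_ac)
  then have cu2: "c * u\<^sup>2 = (1 - c) * a * \<mu>" using c(1) by simp
  \<comment> \<open>Here \<open>\<delta> \<le> 1\<close> enters: it gives \<open>a \<le> u\<close>,
    so the optimal \<open>t = u - a\<close> is not negative.\<close>
  have "c * a \<le> (1 - c) * \<mu>" unfolding ca using \<mu> \<delta> by (simp add: mult.commute)
  then have "c * a * a \<le> (1 - c) * \<mu> * a" using a by (rule mult_right_mono)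
  then have "c * a\<^sup>2 \<le> c * u\<^sup>2" unfolding cu2 by (simp add: power2_eq_square mult_ac)
  then have "a\<^sup>2 \<le> u\<^sup>2" using c(1) by simp
  then have au: "a \<le> u" using u0 by (rule power2_le_imp_le)
  have L: "\<mu> * (sqrt (1 - c) - sqrt (\<delta> - c))\<^sup>2 = c * a + (1 - c) * \<mu> - 2 * (c * u)"
  proof -
    have "\<mu> * (sqrt (1 - c) - sqrt (\<delta> - c))\<^sup>2
      = \<mu> * (sqrt (1 - c))\<^sup>2 + \<mu> * (sqrt (\<delta> - c))\<^sup>2 - 2 * (\<mu> * sqrt (1 - c) * sqrt (\<delta> - c))"
      by (simp only: power2_diff) (simp only: algebra_simps)
    then show ?thesis unfolding sq ca using c(1) by (simp add: u_def algebra_simps)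
  qed
  txt \<open>The supremum over \<open>t > 0\<close> sits at \<open>t = u - a\<close>, which may be \<open>0\<close>; hence the perturbation \<open>\<eta>\<close>.\<close>
  have bound: "\<mu> * (sqrt (1 - c) - sqrt (\<delta> - c))\<^sup>2 \<le> e + c * \<eta>" if \<eta>: "0 < \<eta>" for \<eta>
  proof -
    define w where "w = u + \<eta>"
    have w: "0 < w" "a < w" using u0 au \<eta> by (simp_all add: w_def)
    have "(1 - c) * ((w - a) * (w - a + v) / (w - a + v - \<mu>)) - (w - a)
        = c * a + (1 - c) * \<mu> - c * w - (1 - c) * a * \<mu> / w"
      using w(1) by (simp add: a_def field_simps)
    also have "(1 - c) * a * \<mu> / w = c * u\<^sup>2 / w" by (simp only: cu2)
    finally have "c * a + (1 - c) * \<mu> - c * w - c * u\<^sup>2 / w \<le> e"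
      using e[of "w - a"] w(2) by simp
    \<comment> \<open>Since \<open>w \<ge> u\<close>, the last term costs at most
      \<open>c u\<close>; the total loss against the optimum is at most
      \<open>c \<eta>\<close>.\<close>
    moreover have "c * u\<^sup>2 \<le> c * u * w"
      using c(1) u0 \<eta> by (simp add: w_def power2_eq_square algebra_simps)
    then have "c * u\<^sup>2 / w \<le> c * u"
      using w(1) by (simp add: pos_divide_le_eq)
    ultimately show ?thesis unfolding L by (simp add: w_def algebra_simps)
  qed
  show ?thesis
  proof (rule field_le_epsilon)
    fix x :: real assume "0 < x"
    then show "\<mu> * (sqrt (1 - c) - sqrt (\<delta> - c))\<^sup>2 \<le> e + x"
      using bound[of "x / c"] c(1) by simp
  qed
qed

section \<open>Transfer to matrices\<close>

lemma adjoint_index: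
  assumes "i < dim_col A" "j < dim_row A"
  shows "mat_adjoint A $$ (i, j) = conjugate (A $$ (j, i))"
  using assms unfolding mat_adjoint_def by (subst mat_of_rows_index) auto

lemma positive_mat_psd_on:
  assumes A: "A \<in> carrier_mat n n" and pos: "positive_mat A"
  shows "psd_on {..<n} (\<lambda>i j. A $$ (i, j))"
  unfolding psd_on_def herm_on_def
proof (intro conjI ballI allI)
  fix i j assume ij: "i \<in> {..<n}" "j \<in> {..<n}"
  have "mat_adjoint A = A" using pos by (simp add: positive_mat_def hermitian_mat_def)
  then have "A $$ (j, i) = mat_adjoint A $$ (j, i)" by simp
  also have "\<dots> = cnj (A $$ (i, j))" using A ij by (subst adjoint_index) auto
  finally show "cnj (A $$ (i, j)) = A $$ (j, i)" by simp
next
  fix x :: "nat \<Rightarrow> complex"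
  have "(A *\<^sub>v vec n x) \<bullet>c vec n x = sesq {..<n} (\<lambda>i j. A $$ (i, j)) x x"
    using A by (auto simp: sesq_def scalar_prod_def atLeast0LessThan intro!: sum.cong)
  moreover have "0 \<le> Re ((A *\<^sub>v vec n x) \<bullet>c vec n x)"
    using pos A unfolding positive_mat_def by auto
  ultimately show "0 \<le> Re (sesq {..<n} (\<lambda>i j. A $$ (i, j)) x x)" by simp
qed

text \<open>\<open>pick\<close> enumerates \<open>S\<close> increasingly, so counting smaller
  elements inverts it. This turns sums over positions in a submatrix into sums over
  \<open>S\<close>.\<close>

lemma bij_betw_pick:
  assumes "finite S"
  shows "bij_betw (pick S) {..<card S} S"
proof (rule bij_betwI[of _ _ _ "\<lambda>i. card {a \<in> S. a < i}"])
  show "pick S \<in> {..<card S} \<rightarrow> S" using pick_in_set_le by auto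
  show "(\<lambda>i. card {a \<in> S. a < i}) \<in> S \<rightarrow> {..<card S}"
    using assms by (auto intro!: psubset_card_mono)
  show "card {a \<in> S. a < pick S i} = i" if "i \<in> {..<card S}" for i
    using that card_pick[of i S] assms by simp
  show "pick S (card {a \<in> S. a < i}) = i" if "i \<in> S" for i
    using that by (rule pick_card_in_set)
qed

lemma op_norm_submatrix_le:
  assumes A: "A \<in> carrier_mat n n" and S: "S \<subseteq> {..<n}" and r: "0 \<le> r"
    and le: "\<And>x. (\<Sum>a\<in>S. (cmod (\<Sum>b\<in>S. A $$ (a, b) * x b))\<^sup>2) \<le> r\<^sup>2 * (\<Sum>a\<in>S. (cmod (x a))\<^sup>2)"
  shows "op_norm (submatrix A S S) \<le> r"
proof -
  have fin: "finite S" using S finite_subset by blast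
  have "{i. i < n \<and> i \<in> S} = S" using S by auto
  then have M: "submatrix A S S = mat (card S) (card S) (\<lambda>(i, j). A $$ (pick S i, pick S j))"
    using A by (simp add: submatrix_def)
  note reindex = sum.reindex_bij_betw[OF bij_betw_pick[OF fin]]
  have bound: "vec_l2norm (submatrix A S S *\<^sub>v v) \<le> r"
    if v: "v \<in> carrier_vec (card S)" "vec_l2norm v \<le> 1" for v
  proof -
    \<comment> \<open>The vector \<open>v\<close>, relabelled from positions to elements of
      \<open>S\<close>.\<close>
    define x where "x a = v $ (the_inv_into {..<card S} (pick S) a)" for a
    have x: "x (pick S i) = v $ i" if "i < card S" for i
      using that bij_betw_pick[OF fin] by (simp add: x_def bij_betw_def the_inv_into_f_f)
    have Mv: "(submatrix A S S *\<^sub>v v) $ i = (\<Sum>b\<in>S. A $$ (pick S i, b) * x b)" if "i < card S" for i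
      unfolding reindex[symmetric] using that v(1) x
      by (auto simp: M scalar_prod_def atLeast0LessThan intro!: sum.cong)
    have nx: "(\<Sum>a\<in>S. (cmod (x a))\<^sup>2) = (vec_l2norm v)\<^sup>2"
      unfolding reindex[symmetric] using v(1) x
      by (simp add: vec_l2norm_def L2_set_def sum_nonneg)
    have dim: "dim_vec (submatrix A S S *\<^sub>v v) = card S" by (simp add: M)
    have "(vec_l2norm (submatrix A S S *\<^sub>v v))\<^sup>2
        = (\<Sum>i<card S. (cmod ((submatrix A S S *\<^sub>v v) $ i))\<^sup>2)"
      unfolding vec_l2norm_def dim by (simp add: L2_set_def sum_nonneg)
    also have "\<dots> = (\<Sum>i<card S. (cmod (\<Sum>b\<in>S. A $$ (pick S i, b) * x b))\<^sup>2)"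
      using Mv by simp
    also have "\<dots> = (\<Sum>a\<in>S. (cmod (\<Sum>b\<in>S. A $$ (a, b) * x b))\<^sup>2)"
      by (rule reindex)
    also have "\<dots> \<le> r\<^sup>2 * (vec_l2norm v)\<^sup>2"
      using le[of x] unfolding nx .
    also have "\<dots> \<le> r\<^sup>2 * 1\<^sup>2"
      using v(2) by (intro mult_left_mono power_mono) (auto simp: vec_l2norm_def L2_set_def sum_nonneg)
    finally have "(vec_l2norm (submatrix A S S *\<^sub>v v))\<^sup>2 \<le> r\<^sup>2" by simp
    then show ?thesis using r by (rule power2_le_imp_le)
  qed
  \<comment> \<open>The zero vector makes the set nonempty, as a bound on its supremum
    requires.\<close>
  have "0\<^sub>v (card S) \<in> {v \<in> carrier_vec (card S). vec_l2norm v \<le> 1}"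
    by (simp add: vec_l2norm_def L2_set_def)
  then have ne: "{v \<in> carrier_vec (dim_col (submatrix A S S)). vec_l2norm v \<le> 1} \<noteq> {}"
    unfolding M by (metis dim_col_mat(1) empty_iff)
  show ?thesis
    unfolding op_norm_def
  proof (intro cSUP_least)
    show "vec_l2norm (submatrix A S S *\<^sub>v v) \<le> r"
      if "v \<in> {v \<in> carrier_vec (dim_col (submatrix A S S)). vec_l2norm v \<le> 1}" for v
      using that bound by (simp add: M)
  qed (rule ne)
qed

theorem theorem1p8:
  fixes n :: nat and A B :: "complex mat" and \<delta> c :: real
  assumes "A \<in> carrier_mat n n"
    and "positive_contraction A"
    and "A \<noteq> 1\<^sub>m n"
    and "B = 1\<^sub>m n - A"
    and "0 \<le> \<delta>" and "\<delta> \<le> 1"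
    and "c = \<delta> * ((Re (normalized_trace B))\<^sup>2 / Re (normalized_trace (B ^\<^sub>m 2)))"
    and "c * real n \<in> \<int>" and "0 < c * real n"
  shows "\<exists>S \<subseteq> {0..<n}. real (card S) = c * real n \<and>
    op_norm (submatrix A S S)
      \<le> 1 - Re (normalized_trace B) * (sqrt (1 - c) - sqrt (\<delta> - c))\<^sup>2"
proof -
  define S where "S = {..<n}"
  define a where "a = (\<lambda>i j. A $$ (i, j))"
  define b where "b = (\<lambda>i j. B $$ (i, j))"
  have fin: "finite S" and cardS: "card S = n" by (simp_all add: S_def)
  have B: "B \<in> carrier_mat n n" using assms(1,4) by auto
  have posA: "psd_on S a"
    using positive_mat_psd_on[OF assms(1)] assms(2) by (simp add: positive_contraction_def S_def a_def)
  have posB: "psd_on S b"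
    using positive_mat_psd_on[OF B] assms(1,2,4) by (auto simp: positive_contraction_def S_def b_def)
  have ba: "a i j = kronecker i j - b i j" if "i \<in> S" "j \<in> S" for i j
    using assms(1,4) that by (simp add: S_def a_def b_def kronecker_def)
  define \<mu> where "\<mu> = Re (normalized_trace B)"
  define F where "F = (\<Sum>i\<in>S. \<Sum>j\<in>S. (cmod (b j i))\<^sup>2)"
  have n: "0 < n" and cpos: "0 < c" using assms(9) by (auto simp: zero_less_mult_iff intro: Nat.gr0I)
  have \<mu>: "\<mu> = trace_on S b / n"
    using B by (simp add: \<mu>_def normalized_trace_def mat_trace_def trace_on_def S_def b_def)
  have tr: "trace_on S b = n * \<mu>" using \<mu> n by simp
  have "Re (normalized_trace (B ^\<^sub>m 2)) = Re (mat_trace (B * B)) / n"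
    using B by (simp add: normalized_trace_def numeral_2_eq_2)
  also have "mat_trace (B * B) = (\<Sum>i\<in>S. \<Sum>j\<in>S. b i j * b j i)"
    using B by (auto simp: mat_trace_def S_def b_def scalar_prod_def atLeast0LessThan intro!: sum.cong)
  also have "\<dots> = (\<Sum>i\<in>S. \<Sum>j\<in>S. b j i * cnj (b j i))"
    using psd_on_herm[OF posB] by (intro sum.cong refl) (simp add: herm_on_def)
  also have "\<dots> = complex_of_real F"
    unfolding F_def of_real_sum complex_norm_square ..
  finally have trB2: "Re (normalized_trace (B ^\<^sub>m 2)) = F / n" by simp
  have c: "c = \<delta> * (\<mu>\<^sup>2 / (F / n))" using assms(7) unfolding trB2 \<mu>_def[symmetric] .
  \<comment> \<open>If either were zero, \<open>c\<close> would be \<open>0\<close>, since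
    \<open>x / 0 = 0\<close>.\<close>
  have F0: "F \<noteq> 0" and \<mu>0: "\<mu> \<noteq> 0" using c cpos by auto
  have "0 \<le> Re (b i i)" if "i \<in> S" for i
    using psd_on_nonneg[OF posB, of "kronecker i"] fin that by (simp add: sesq_kronecker_kronecker)
  then have "0 \<le> trace_on S b" unfolding trace_on_def by (rule sum_nonneg)
  then have \<mu>pos: "0 < \<mu>" using \<mu>0 unfolding \<mu> by simp
  have "0 \<le> F" unfolding F_def by (intro sum_nonneg) auto
  then have Fpos: "0 < F" using F0 by simp
  \<comment> \<open>This is \<open>Tr (B^2) / Tr B\<close>; the formula for \<open>c\<close> then
    reads \<open>c v = \<delta> \<mu>\<close>.\<close>
  define v where "v = F / (n * \<mu>)"
  have v0: "0 \<le> v" using Fpos \<mu>pos by (simp add: v_def)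
  have Fv: "F = v * trace_on S b" using \<mu>pos n by (simp add: v_def tr)
  have cv: "c * v = \<delta> * \<mu>" using F0 \<mu>0 n by (simp add: c v_def power2_eq_square)
  \<comment> \<open>Cauchy-Schwarz on the diagonal, \<open>(Tr B)^2 \<le> n Tr (B^2)\<close>; it
    yields \<open>c \<le> \<delta>\<close>.\<close>
  have "(n * \<mu>)\<^sup>2 \<le> n * F"
  proof -
    have "(\<Sum>i\<in>S. Re (b i i))\<^sup>2 \<le> (\<Sum>i\<in>S. (Re (b i i))\<^sup>2) * real (card S)"
      by (rule sum_squared_le_sum_of_squares)
    also have "(\<Sum>i\<in>S. (Re (b i i))\<^sup>2) \<le> F"
      unfolding F_def
    proof (rule sum_mono)
      fix i assume "i \<in> S"
      have "(Re (b i i))\<^sup>2 \<le> (cmod (b i i))\<^sup>2"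
        using abs_Re_le_cmod[of "b i i"] by (metis abs_ge_zero power2_abs power_mono)
      also have "\<dots> \<le> (\<Sum>j\<in>S. (cmod (b j i))\<^sup>2)"
        using fin \<open>i \<in> S\<close> by (intro member_le_sum[of i S "\<lambda>j. (cmod (b j i))\<^sup>2"]) auto
      finally show "(Re (b i i))\<^sup>2 \<le> (\<Sum>j\<in>S. (cmod (b j i))\<^sup>2)" .
    qed
    finally have "(trace_on S b)\<^sup>2 \<le> F * n"
      by (simp add: trace_on_def cardS mult_right_mono)
    then show ?thesis unfolding tr by (simp add: mult.commute)
  qed
  then have "n * (n * \<mu>\<^sup>2) \<le> n * F" by (simp add: power2_eq_square mult_ac)
  then have "n * \<mu>\<^sup>2 \<le> F" using n by simp
  then have "\<mu>\<^sup>2 / (F / n) \<le> 1" using Fpos by (simp add: mult.commute)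
  then have c\<delta>: "c \<le> \<delta>" unfolding c using assms(5) by (rule mult_left_le)
  obtain k where k: "real k = c * n"
  proof -
    obtain z where z: "c * n = of_int z" using assms(8) by (auto elim: Ints_cases)
    then have "0 < z" using assms(9) by simp
    then show thesis using that[of "nat z"] z by simp
  qed
  have "c * real n \<le> 1 * real n" using c\<delta> assms(6) by (intro mult_right_mono) auto
  then have "real k \<le> real n" using k by simp
  then have kn: "k \<le> n" by simp
  have kpos: "0 < k" using k assms(9) by simp
  define C where "C = {T. T \<subseteq> S \<and> card T = k}"
  define g where "g T = op_norm (submatrix A T T)" for T
  have finC: "finite (g ` C)" using fin by (simp add: C_def)
  have bound: "\<exists>T\<in>C. g T \<le> 1 + t - (1 - c) * n * s"
    if t: "0 < t" and s: "0 < s" "s * (n * (t + v - \<mu>)) < t * (t + v)" for t s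
  proof -
    obtain T where T: "T \<subseteq> S" "card T = k" "psd_on T (shift b (real (n - k) * s - t))"
      using restricted_lower_bound[OF fin posB t v0 Fv[unfolded F_def] s(1), of k] s(2) kn
      by (auto simp: cardS tr algebra_simps)
    \<comment> \<open>As \<open>k = c n\<close>, the final barrier \<open>(n - k) s - t\<close> is
      \<open>1 - r\<close>; since \<open>A = 1 - B\<close>, this becomes the upper bound
      \<open>r\<close> for the form of \<open>A\<close> on \<open>T\<close>.\<close>
    define r where "r = 1 + t - (1 - c) * n * s"
    have "real (n - k) * s - t = 1 - r"
      using kn k by (simp add: r_def of_nat_diff algebra_simps)
    with T(3) have psd: "psd_on T (shift b (1 - r))" by simp
    have finT: "finite T" using T(1) fin finite_subset by blast
    have upper: "Re (sesq T a x x) \<le> r * (\<Sum>i\<in>T. (cmod (x i))\<^sup>2)" for x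
    proof -
      have "sesq T a x x = sesq T (\<lambda>i j. kronecker i j - b i j) x x"
        unfolding sesq_def using T(1) ba by (intro sum.cong refl arg_cong2[where f = "(*)"]) auto
      also have "\<dots> = (\<Sum>i\<in>T. x i * cnj (x i)) - sesq T b x x"
        using finT by (simp add: sesq_def left_diff_distrib sum_subtractf)
      finally have "Re (sesq T a x x) = (\<Sum>i\<in>T. (cmod (x i))\<^sup>2) - Re (sesq T b x x)"
        unfolding sum_mult_cnj by simp
      moreover have "0 \<le> Re (sesq T b x x) - (1 - r) * (\<Sum>i\<in>T. (cmod (x i))\<^sup>2)"
        using psd_on_nonneg[OF psd, of x] unfolding sesq_shift[OF finT] sum_mult_cnj by simp
      ultimately show ?thesis by (simp add: algebra_simps)
    qed
    have psda: "psd_on T a" using psd_on_subset[OF fin T(1) posA] .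
    \<comment> \<open>A unit vector on the nonempty \<open>T\<close> squeezes \<open>0\<close> below
      \<open>r\<close>, which the norm bound requires.\<close>
    obtain i where i: "i \<in> T" using T(2) kpos by fastforce
    have "(\<Sum>j\<in>T. (cmod (kronecker i j))\<^sup>2) = (\<Sum>j\<in>T. if i = j then 1 else 0)"
      by (intro sum.cong) (auto simp: kronecker_def)
    then have "(\<Sum>j\<in>T. (cmod (kronecker i j))\<^sup>2) = 1" using i finT by simp
    then have "0 \<le> r"
      using upper[of "kronecker i"] psd_on_nonneg[OF psda, of "kronecker i"] by simp
    then have "g T \<le> r"
      unfolding g_def using T(1) psd_on_operator_bound[OF psda upper]
      by (intro op_norm_submatrix_le[OF assms(1)]) (auto simp: S_def a_def)
    then show ?thesis using T by (auto simp: C_def r_def)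
  qed
  have vmu: "\<mu> \<le> v"
  proof -
    have "c * \<mu> \<le> c * v" unfolding cv using c\<delta> \<mu>pos by (simp add: mult_right_mono)
    then show ?thesis using cpos by simp
  qed
  \<comment> \<open>The minimum over all candidates serves every pair \<open>(t, s)\<close> at once,
    although the subset found may vary with the pair.\<close>
  define e where "e = 1 - Min (g ` C)"
  have neC: "C \<noteq> {}"
    using obtain_subset_with_card_n[of k S] kn cardS by (auto simp: C_def)
  have le: "(1 - c) * n * s - t \<le> e"
    if ts: "0 < t" "0 < s" "s * (n * (t + v - \<mu>)) < t * (t + v)" for t s
  proof -
    obtain T where "T \<in> C" "g T \<le> 1 + t - (1 - c) * n * s"
      using bound[OF ts] by blast
    moreover have "Min (g ` C) \<le> g T" using finC \<open>T \<in> C\<close> by simp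
    ultimately show ?thesis by (simp add: e_def)
  qed
  have "\<mu> * (sqrt (1 - c) - sqrt (\<delta> - c))\<^sup>2 \<le> e"
  proof (rule optimise_shift[OF \<mu>pos cpos c\<delta> assms(6) cv])
    fix t :: real assume t: "0 < t"
    define w where "w = t * (t + v) / (t + v - \<mu>)"
    have d: "0 < t + v - \<mu>" using t vmu by simp
    have w: "0 < w" using t v0 d by (simp add: w_def)
    \<comment> \<open>The step \<open>w / n\<close> itself is excluded by the strict inequality, so
      it is scaled by \<open>z < 1\<close> and \<open>z\<close> tends to \<open>1\<close>.\<close>
    have "z * ((1 - c) * w) \<le> e + t" if z: "0 < z" "z < 1" for z
    proof -
      have "z * w * (t + v - \<mu>) = z * (t * (t + v))" using d by (simp add: w_def)
      also have "\<dots> < 1 * (t * (t + v))"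
        using z t v0 by (intro mult_strict_right_mono) auto
      finally show ?thesis
        using le[of t "z * w / n"] t z w n by (simp add: mult_ac)
    qed
    then have "(1 - c) * w \<le> e + t" by (rule field_le_mult_one_interval)
    then show "(1 - c) * (t * (t + v) / (t + v - \<mu>)) - t \<le> e" by (simp add: w_def)
  qed
  moreover have "Min (g ` C) \<in> g ` C" using finC neC by (intro Min_in) auto
  then obtain T where "T \<in> C" "g T = Min (g ` C)" by auto
  ultimately have "T \<subseteq> {0..<n} \<and> real (card T) = c * real n \<and>
      op_norm (submatrix A T T) \<le> 1 - \<mu> * (sqrt (1 - c) - sqrt (\<delta> - c))\<^sup>2"
    using k by (auto simp: C_def S_def g_def e_def)
  then show ?thesis unfolding \<mu>_def by blast
qed

end
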